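(* Let $\sigma_1,\sigma_2$ be RAM memory states and let $p$ be a basic RAM property. If $\sigma_1 \restriction \mathrm{ireg}(p) = \sigma_2 \restriction \mathrm{ireg}(p)$, then $p(\sigma_1) = p(\sigma_2)$.
   Context: Let $\{0,1\}^*$ denote the set of finite bit strings and $\varepsilon$ the empty bit string. A RAM memory state is a function $\sigma:\mathbb{N}\to\{0,1\}^*$ such that there exists $i\in\mathbb{N}$ with $\sigma(i+j)=\varepsilon$ for all $j\in\mathbb{N}$; let $\mathit{MS}$ be the set of all RAM memory states. For a function $p:\mathit{MS}\to\{0,1\}$ define its input region $\mathrm{ireg}(p)=\{i\in\mathbb{N} : \exists \sigma_1,\sigma_2\in\mathit{MS}\ (\forall j\in\mathbb{N}\setminus\{i\}\ \sigma_1(j)=\sigma_2(j)) \wedge p(\sigma_1)\neq p(\sigma_2)\}$. A basic RAM property is a function $p:\mathit{MS}\to\{0,1\}$ such that $\mathrm{ireg}(p)$ is finite. For a function $f$ and $D\subseteq\mathrm{dom}(f)$, $f\restriction D$ denotes the restriction of $f$ to $D$. *)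

theory Defs
  imports Main "HOL-Library.FuncSet"
begin

text \<open>
  The bits 0 and 1 are rendered as \<^const>\<open>False\<close> and \<^const>\<open>True\<close>,
  and the empty bit string is the empty list.
\<close>

type_synonym bitstring = "bool list"

definition MS :: "(nat \<Rightarrow> bitstring) set" where
  "MS = {\<sigma>. \<exists>i. \<forall>j. \<sigma> (i + j) = []}"

text \<open>
  A function from \<^term>\<open>MS\<close> to bits is represented by a total function on
  \<^typ>\<open>nat \<Rightarrow> bitstring\<close> whose values outside \<^term>\<open>MS\<close> are irrelevant:
  the input region only inspects values on \<^term>\<open>MS\<close>.
\<close>

definition ireg :: "((nat \<Rightarrow> bitstring) \<Rightarrow> bool) \<Rightarrow> nat set" where
  "ireg p = {i. \<exists>\<sigma>\<^sub>1\<in>MS. \<exists>\<sigma>\<^sub>2\<in>MS. (\<forall>j\<in>UNIV - {i}. \<sigma>\<^sub>1 j = \<sigma>\<^sub>2 j) \<and> p \<sigma>\<^sub>1 \<noteq> p \<sigma>\<^sub>2}"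

definition basic_RAM_property :: "((nat \<Rightarrow> bitstring) \<Rightarrow> bool) \<Rightarrow> bool" where
  "basic_RAM_property p \<longleftrightarrow> finite (ireg p)"

end

theory Submission
  imports Defs
begin

text \<open>
  Two memory states differ at only finitely many addresses, so one can be turned into the other by
  finitely many single-address updates. If the states agree on the input region, every updated
  address lies outside it, so no update changes the value of the property.
\<close>

text \<open>Finite support is easier to handle than an eventually empty tail: it passes directly to
  updated states and to the set of addresses where two states differ.\<close>

lemma MS_iff_finite: "\<sigma> \<in> MS \<longleftrightarrow> finite {i. \<sigma> i \<noteq> []}"
proof
  assume "\<sigma> \<in> MS"
  then obtain i where i: "\<And>j. \<sigma> (i + j) = []"
    by (auto simp: MS_def)
  have "{k. \<sigma> k \<noteq> []} \<subseteq> {..<i}"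
    using i by (metis (mono_tags) lessThan_iff mem_Collect_eq not_less le_Suc_ex subsetI)
  then show "finite {k. \<sigma> k \<noteq> []}"
    by (rule finite_subset) simp
next
  assume "finite {i. \<sigma> i \<noteq> []}"
  then obtain m where m: "\<And>k. \<sigma> k \<noteq> [] \<Longrightarrow> k < m"
    by (auto simp: finite_nat_set_iff_bounded)
  have "\<sigma> (m + j) = []" for j
    using m[of "m + j"] by auto
  then show "\<sigma> \<in> MS"
    by (auto simp: MS_def)
qed

text \<open>Keeps the intermediate states inside \<open>MS\<close>; \<open>ireg\<close> compares
  values of \<open>p\<close> only there.\<close>

lemma MS_update:
  assumes "\<sigma> \<in> MS"
  shows "\<sigma>(i := w) \<in> MS"
proof -
  have "{k. (\<sigma>(i := w)) k \<noteq> []} \<subseteq> insert i {k. \<sigma> k \<noteq> []}"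
    by auto
  then show ?thesis
    using assms unfolding MS_iff_finite by (metis finite_insert finite_subset)
qed

lemma eq_of_not_in_ireg:
  assumes "\<sigma> \<in> MS" and "\<tau> \<in> MS" and "i \<notin> ireg p" and "\<And>j. j \<noteq> i \<Longrightarrow> \<sigma> j = \<tau> j"
  shows "p \<sigma> = p \<tau>"
  using assms unfolding ireg_def by blast

lemma eq_of_finite_diff:
  assumes "finite D" and "D \<inter> ireg p = {}" and "\<sigma> \<in> MS" and "\<tau> \<in> MS"
    and "\<And>i. i \<notin> D \<Longrightarrow> \<sigma> i = \<tau> i"
  shows "p \<sigma> = p \<tau>"
  using assms
proof (induction D arbitrary: \<sigma> rule: finite_induct)
  case empty
  then have "\<sigma> = \<tau>" by auto
  then show ?case by simp
next
  case (insert x D)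
  \<comment> \<open>One step from \<open>\<sigma>\<close> towards the fixed target
    \<open>\<tau>\<close>: the change is at \<open>x\<close>, outside \<open>ireg p\<close>, and the
    new state can differ from \<open>\<tau>\<close> only on \<open>D\<close>. The induction
    hypothesis is applied to this new state, hence the generalization over
    \<open>\<sigma>\<close>.\<close>
  let ?\<rho> = "\<sigma>(x := \<tau> x)"
  have MS: "?\<rho> \<in> MS"
    using insert.prems by (simp add: MS_update)
  have "p \<sigma> = p ?\<rho>"
    using insert.prems by (intro eq_of_not_in_ireg[where i = x] MS) auto
  also have "p ?\<rho> = p \<tau>"
    using insert.prems by (intro insert.IH MS) auto
  finally show ?case .
qed

theorem theorem6:
  fixes \<sigma>\<^sub>1 \<sigma>\<^sub>2 :: "nat \<Rightarrow> bitstring" and p :: "(nat \<Rightarrow> bitstring) \<Rightarrow> bool"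
  assumes "\<sigma>\<^sub>1 \<in> MS" and "\<sigma>\<^sub>2 \<in> MS"
    and "basic_RAM_property p"
    and "restrict \<sigma>\<^sub>1 (ireg p) = restrict \<sigma>\<^sub>2 (ireg p)"
  shows "p \<sigma>\<^sub>1 = p \<sigma>\<^sub>2"
proof (rule eq_of_finite_diff)
  let ?D = "{i. \<sigma>\<^sub>1 i \<noteq> \<sigma>\<^sub>2 i}"
  \<comment> \<open>Where the states differ, they cannot both hold the empty string.\<close>
  have "?D \<subseteq> {i. \<sigma>\<^sub>1 i \<noteq> []} \<union> {i. \<sigma>\<^sub>2 i \<noteq> []}"
    by auto
  then show "finite ?D"
    using assms(1,2) by (auto simp: MS_iff_finite intro: finite_subset)
  have "\<sigma>\<^sub>1 i = \<sigma>\<^sub>2 i" if "i \<in> ireg p" for i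
    using fun_cong[OF assms(4), of i] that by simp
  then show "?D \<inter> ireg p = {}"
    by auto
qed (use assms in auto)

end
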